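(* Let $\mathcal{G}=(V,E)$ be a simple directed graph on $V=\{1,\dots,n\}$, let $C\in\mathrm{PD}_n$, and let $\mathcal{G}'$ be a completion of $\mathcal{G}$. A positive definite matrix $\Sigma\in\mathrm{PD}_n$ belongs to $\mathcal{M}_{\mathcal{G},C}$ if and only if $f^{ij}_{\mathcal{G}'}(\Sigma;C)=0$ for every edge $i\to j\in E(\mathcal{G}')\setminus E(\mathcal{G})$.
   Context: All graphs are finite directed graphs $\mathcal{G}=(V,E)$, $E=E(\mathcal{G})$, without multiple edges, whose edge set contains every self-loop $i\to i$. A graph is simple if for all distinct $i,j$ it contains at most one of $i\to j$, $j\to i$ (directed cycles are allowed). $\mathbb{R}^E$ is the set of real $n\times n$ matrices $M$ with $m_{ji}=0$ whenever $i\to j\notin E$; a matrix is stable if all its eigenvalues have strictly negative real part; $\mathrm{PD}_n$ is the set of real symmetric positive definite $n\times n$ matrices. Define $$\mathcal{M}_{\mathcal{G},C}=\{\Sigma\in\mathrm{PD}_n : M\Sigma+\Sigma M^T+C=0\text{ for some stable }M\in\mathbb{R}^E\}.$$ A completion of a simple graph $\mathcal{G}$ is a simple graph $\mathcal{G}'$ on the same vertex set with $E(\mathcal{G})\subseteq E(\mathcal{G}')$ and $|E(\mathcal{G}')|=\binom{n+1}{2}$. For a graph $\mathcal{G}$ and symmetric $\Sigma=(\sigma_{ij})$, $A_{\mathcal{G}}(\Sigma)$ is the $\binom{n+1}{2}\times|E|$ matrix with rows indexed by pairs $(k,l)$, $k\le l$, and columns indexed by edges $i\to j\in E$, with entries $A_{\mathcal{G}}(\Sigma)_{(k,l),i\to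 j}$ equal to: $0$ if $j\ne k$ and $j\neq l$; $\sigma_{li}$ if $j=k\ne l$; $\sigma_{ki}$ if $j=l\neq k$; $2\sigma_{ji}$ if $j=k=l$. Let $\mathrm{vech}(C)=(c_{kl}:k\le l)$. For $i\to j\in E(\mathcal{G}')$, $A^{ij}_{\mathcal{G}'}(\Sigma;C)$ is the square matrix obtained from $A_{\mathcal{G}'}(\Sigma)$ by replacing the column indexed by $i\to j$ with $-\mathrm{vech}(C)$, and $f^{ij}_{\mathcal{G}'}(\Sigma;C)=\det\big(A^{ij}_{\mathcal{G}'}(\Sigma;C)\big)$. *)

theory Defs
  imports
    "Jordan_Normal_Form.Char_Poly"
    "Jordan_Normal_Form.Determinant"
    "Graph_Theory.Pair_Digraph"
    "HOL.Complex"
begin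

text \<open>
  The vertex set \<open>{1, \<dots>, n}\<close> is rendered as \<open>{0..<n}\<close>, in accordance with the 0-based indices
  of matrices. Graphs are pair digraphs, which have no parallel arcs; an arc \<open>i \<rightarrow> j\<close> is the
  pair \<open>(i, j)\<close>.
\<close>

definition looped_digraph :: "nat \<Rightarrow> nat pair_pre_digraph \<Rightarrow> bool" where
  "looped_digraph n G \<longleftrightarrow>
     pair_fin_digraph G \<and> pverts G = {0..<n} \<and> (\<forall>i\<in>pverts G. (i, i) \<in> parcs G)"

text \<open>Directed cycles of length at least three are allowed.\<close>

definition simple_digraph :: "nat \<Rightarrow> nat pair_pre_digraph \<Rightarrow> bool" where
  "simple_digraph n G \<longleftrightarrow>
     looped_digraph n G \<and> (\<forall>i j. i \<noteq> j \<longrightarrow> \<not> ((i, j) \<in> parcs G \<and> (j, i) \<in> parcs G))"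

definition completion :: "nat \<Rightarrow> nat pair_pre_digraph \<Rightarrow> nat pair_pre_digraph \<Rightarrow> bool" where
  "completion n G G' \<longleftrightarrow>
     simple_digraph n G \<and> simple_digraph n G' \<and>
     parcs G \<subseteq> parcs G' \<and> card (parcs G') = (n + 1) choose 2"

text \<open>Note the transposition: the arc \<open>i \<rightarrow> j\<close> permits a nonzero entry in row \<open>j\<close>, column \<open>i\<close>.\<close>

definition graph_mats :: "nat \<Rightarrow> nat pair_pre_digraph \<Rightarrow> real mat set" where
  "graph_mats n G =
     {M \<in> carrier_mat n n. \<forall>i<n. \<forall>j<n. (i, j) \<notin> parcs G \<longrightarrow> M $$ (j, i) = 0}"

definition stable :: "real mat \<Rightarrow> bool" where
  "stable M \<longleftrightarrow> (\<forall>z. eigenvalue (map_mat complex_of_real M) z \<longrightarrow> Re z < 0)"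

definition PD :: "nat \<Rightarrow> real mat set" where
  "PD n = {S \<in> carrier_mat n n.
     S\<^sup>T = S \<and> (\<forall>v\<in>carrier_vec n. v \<noteq> 0\<^sub>v n \<longrightarrow> 0 < v \<bullet> (S *\<^sub>v v))}"

definition lyapunov_model :: "nat \<Rightarrow> nat pair_pre_digraph \<Rightarrow> real mat \<Rightarrow> real mat set" where
  "lyapunov_model n G C =
     {S \<in> PD n. \<exists>M\<in>graph_mats n G. stable M \<and> M * S + S * M\<^sup>T + C = 0\<^sub>m n n}"

text \<open>
  Determinants of matrices indexed by pairs and arcs require an enumeration of both index sets;
  here both are enumerated lexicographically. Any other choice changes the determinants below
  only by a sign.
\<close>

definition vech_pairs :: "nat \<Rightarrow> (nat \<times> nat) list" where
  "vech_pairs n = [(k, l). k \<leftarrow> [0..<n], l \<leftarrow> [k..<n]]"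

definition arc_list :: "nat \<Rightarrow> nat pair_pre_digraph \<Rightarrow> (nat \<times> nat) list" where
  "arc_list n G = [(i, j). i \<leftarrow> [0..<n], j \<leftarrow> [0..<n], (i, j) \<in> parcs G]"

lemma set_vech_pairs: "set (vech_pairs n) = {(k, l). k \<le> l \<and> l < n}"
  by (force simp: vech_pairs_def)

lemma length_vech_pairs: "length (vech_pairs n) = (n + 1) choose 2"
proof -
  have "length (vech_pairs n) = (\<Sum>k\<leftarrow>[0..<n]. n - k)"
    by (simp add: vech_pairs_def length_concat comp_def)
  also have "\<dots> = (\<Sum>k = 0..<n. n - k)"
    by (simp add: sum_list_distinct_conv_sum_set)
  also have "\<dots> = (n + 1) choose 2"
  proof (induction n)
    case (Suc n)
    have "(\<Sum>k = 0..<Suc n. Suc n - k) = Suc n + (\<Sum>k = 0..<n. n - k)"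
      by (subst sum.atLeast0_lessThan_Suc_shift) simp
    then show ?case
      using Suc by (simp add: numeral_2_eq_2)
  qed simp
  finally show ?thesis .
qed

lemma distinct_vech_pairs: "distinct (vech_pairs n)"
proof (rule card_distinct)
  have "set (vech_pairs n) = Sigma {0..<n} (\<lambda>k. {k..<n})"
    by (auto simp: set_vech_pairs)
  then have "card (set (vech_pairs n)) = (\<Sum>k = 0..<n. n - k)"
    by simp
  also have "\<dots> = length (vech_pairs n)"
    by (simp add: vech_pairs_def length_concat comp_def sum_list_distinct_conv_sum_set)
  finally show "card (set (vech_pairs n)) = length (vech_pairs n)" .
qed

lemma arc_list_filter:
  "arc_list n G = filter (\<lambda>e. e \<in> parcs G) (List.product [0..<n] [0..<n])"
proof -
  have *: "concat (map (\<lambda>j. if (i, j) \<in> parcs G then [(i, j)] else []) ys) =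
      filter (\<lambda>e. e \<in> parcs G) (map (Pair i) ys)" for i ys
    by (induction ys) auto
  show ?thesis
    unfolding arc_list_def * product_concat_map filter_concat
    by (simp add: comp_def)
qed

lemma set_arc_list: "looped_digraph n G \<Longrightarrow> set (arc_list n G) = parcs G"
  by (auto simp: looped_digraph_def arc_list_filter pair_fin_digraph_def pair_wf_digraph_def)

lemma distinct_arc_list: "distinct (arc_list n G)"
  by (simp add: arc_list_filter distinct_product)

lemma length_arc_list: "looped_digraph n G \<Longrightarrow> length (arc_list n G) = card (parcs G)"
  by (metis distinct_arc_list distinct_card set_arc_list)

definition arc_index :: "nat \<Rightarrow> nat pair_pre_digraph \<Rightarrow> nat \<times> nat \<Rightarrow> nat" where
  "arc_index n G e = (THE c. c < length (arc_list n G) \<and> arc_list n G ! c = e)"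

definition A_entry :: "real mat \<Rightarrow> nat \<times> nat \<Rightarrow> nat \<times> nat \<Rightarrow> real" where
  "A_entry S = (\<lambda>(k, l) (i, j).
     if j \<noteq> k \<and> j \<noteq> l then 0
     else if j = k \<and> k \<noteq> l then S $$ (l, i)
     else if j = l \<and> l \<noteq> k then S $$ (k, i)
     else 2 * S $$ (j, i))"

definition A_mat :: "nat \<Rightarrow> nat pair_pre_digraph \<Rightarrow> real mat \<Rightarrow> real mat" where
  "A_mat n G S = mat ((n + 1) choose 2) (card (parcs G))
     (\<lambda>(r, c). A_entry S (vech_pairs n ! r) (arc_list n G ! c))"

definition vech :: "nat \<Rightarrow> real mat \<Rightarrow> real vec" where
  "vech n C = vec ((n + 1) choose 2) (\<lambda>r. C $$ (vech_pairs n ! r))"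

definition A_repl ::
    "nat \<Rightarrow> nat pair_pre_digraph \<Rightarrow> nat \<times> nat \<Rightarrow> real mat \<Rightarrow> real mat \<Rightarrow> real mat" where
  "A_repl n G e S C = replace_col (A_mat n G S) (- vech n C) (arc_index n G e)"

definition f_poly ::
    "nat \<Rightarrow> nat pair_pre_digraph \<Rightarrow> nat \<times> nat \<Rightarrow> real mat \<Rightarrow> real mat \<Rightarrow> real" where
  "f_poly n G e S C = det (A_repl n G e S C)"

end

(* On matrices supported on the completion, the Lyapunov equation is a square linear system with
   coefficient matrix A. It is regular: in the kernel, M S is skew-symmetric, which together
   with the sparsity pattern of a simple graph forces M = 0. By Cramer's rule the determinants f
   are, up to the factor det A, the entries of the unique solution M, so their vanishing off G
   says that M is supported on G; stability of M is automatic by Lyapunov's theorem. *)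
theory Submission
  imports Defs
begin

section \<open>Positive definite matrices\<close>

lemma PD_carrier: "S \<in> PD n \<Longrightarrow> S \<in> carrier_mat n n"
  by (simp add: PD_def)

lemma PD_transpose: "S \<in> PD n \<Longrightarrow> S\<^sup>T = S"
  by (simp add: PD_def)

lemma PD_sym_entry:
  assumes "S \<in> PD n" "i < n" "j < n"
  shows "S $$ (i, j) = S $$ (j, i)"
  using assms by (metis PD_carrier PD_transpose carrier_matD index_transpose_mat(1))

lemma PD_pos: "S \<in> PD n \<Longrightarrow> v \<in> carrier_vec n \<Longrightarrow> v \<noteq> 0\<^sub>v n \<Longrightarrow> 0 < v \<bullet> (S *\<^sub>v v)"
  by (simp add: PD_def)

lemma PD_nonneg:
  assumes "S \<in> PD n" "v \<in> carrier_vec n"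
  shows "0 \<le> v \<bullet> (S *\<^sub>v v)"
proof (cases "v = 0\<^sub>v n")
  case True
  then show ?thesis
    using PD_carrier[OF assms(1)] by (simp add: scalar_prod_left_zero[of _ n])
qed (use PD_pos[OF assms] in simp)

lemma PD_form_commute:
  assumes "S \<in> PD n" "v \<in> carrier_vec n" "w \<in> carrier_vec n"
  shows "v \<bullet> (S *\<^sub>v w) = w \<bullet> (S *\<^sub>v v)"
proof -
  have "v \<bullet> (S *\<^sub>v w) = (S *\<^sub>v v) \<bullet> w"
    using transpose_vec_mult_scalar[OF PD_carrier[OF assms(1)] assms(3,2)]
    by (simp add: PD_transpose[OF assms(1)])
  also have "\<dots> = w \<bullet> (S *\<^sub>v v)"
    using assms PD_carrier[OF assms(1)] by (intro comm_scalar_prod[of _ n]) auto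
  finally show ?thesis .
qed

text \<open>The transpose kills the \<open>k\<close>-th unit vector, so both determinants vanish.
  This yields a vector orthogonal to fewer than \<open>n\<close> given ones without dimension
  theory.\<close>

lemma zero_row_kernel:
  fixes A :: "real mat"
  assumes A: "A \<in> carrier_mat n n" and k: "k < n" and zero: "row A k = 0\<^sub>v n"
  obtains v where "v \<in> carrier_vec n" "v \<noteq> 0\<^sub>v n" "A *\<^sub>v v = 0\<^sub>v n"
proof -
  have "A\<^sup>T *\<^sub>v unit_vec n k = col A\<^sup>T k"
    using A k by (intro eq_vecI) auto
  also have "\<dots> = 0\<^sub>v n"
    using A k zero by simp
  finally have "det A\<^sup>T = 0"
    using A k by (subst det_0_iff_vec_prod_zero_field[of _ n]) (auto intro!: exI[of _ "unit_vec n k"])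
  then have "det A = 0"
    using det_transpose[OF A] by simp
  then show ?thesis
    using that det_0_iff_vec_prod_zero_field[OF A] by blast
qed

text \<open>Gram-Schmidt for the form of \<open>S\<close>, except that the next vector comes from
  the kernel of a singular matrix instead of from a projection, and is then normalised.\<close>

lemma PD_orthonormal_family:
  assumes S: "S \<in> PD n" and "k \<le> n"
  shows "\<exists>u. (\<forall>i<k. u i \<in> carrier_vec n) \<and>
    (\<forall>i<k. \<forall>j<k. u i \<bullet> (S *\<^sub>v u j) = (if i = j then 1 else 0))"
  using \<open>k \<le> n\<close>
proof (induction k)
  case (Suc k)
  then obtain u where u: "\<And>i. i < k \<Longrightarrow> u i \<in> carrier_vec n"
    and ortho: "\<And>i j. i < k \<Longrightarrow> j < k \<Longrightarrow> u i \<bullet> (S *\<^sub>v u j) = (if i = j then 1 else 0)"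
    by auto
  note Sc = PD_carrier[OF S]
  \<comment> \<open>Row \<open>i < k\<close> represents the functional pairing with
    \<open>u i\<close> under \<open>S\<close>. Zero rows pad \<open>A\<close> to a square; row
    \<open>k\<close> is one of them since \<open>Suc k \<le> n\<close>.\<close>
  define A where "A = mat n n (\<lambda>(i, j). if i < k then (S *\<^sub>v u i) $ j else 0)"
  have A: "A \<in> carrier_mat n n"
    by (simp add: A_def)
  have "row A k = 0\<^sub>v n"
    using Suc.prems by (intro eq_vecI) (auto simp: A_def)
  then obtain v where v: "v \<in> carrier_vec n" "v \<noteq> 0\<^sub>v n" and Av: "A *\<^sub>v v = 0\<^sub>v n"
    using zero_row_kernel[OF A] Suc.prems by (metis Suc_le_lessD)
  have orthv: "u i \<bullet> (S *\<^sub>v v) = 0" if "i < k" for i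
  proof -
    have "row A i = S *\<^sub>v u i"
      using that Suc.prems Sc by (intro eq_vecI) (auto simp: A_def)
    moreover have "(A *\<^sub>v v) $ i = row A i \<bullet> v"
      using A that Suc.prems by simp
    ultimately have "(S *\<^sub>v u i) \<bullet> v = 0"
      using Av that Suc.prems by simp
    then have "v \<bullet> (S *\<^sub>v u i) = 0"
      using comm_scalar_prod[of "S *\<^sub>v u i" n v] Sc u[OF that] v by simp
    then show ?thesis
      using PD_form_commute[OF S] u[OF that] v by simp
  qed
  define q where "q = v \<bullet> (S *\<^sub>v v)"
  have q: "q > 0"
    using PD_pos[OF S v] by (simp add: q_def)
  define w where "w = (1 / sqrt q) \<cdot>\<^sub>v v"
  have w: "w \<in> carrier_vec n"
    using v by (simp add: w_def)
  have Sw: "S *\<^sub>v w = (1 / sqrt q) \<cdot>\<^sub>v (S *\<^sub>v v)"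
    unfolding w_def using Sc v by (simp add: mult_mat_vec)
  have uw: "u i \<bullet> (S *\<^sub>v w) = 0" if "i < k" for i
    unfolding Sw using orthv[OF that] u[OF that] Sc v by simp
  have wu: "w \<bullet> (S *\<^sub>v u i) = 0" if "i < k" for i
    using uw[OF that] PD_form_commute[OF S w u[OF that]] by simp
  have "w \<bullet> (S *\<^sub>v v) = (1 / sqrt q) * q"
    unfolding w_def q_def using Sc v by simp
  then have "w \<bullet> (S *\<^sub>v w) = (1 / sqrt q) * ((1 / sqrt q) * q)"
    unfolding Sw using Sc v w by simp
  then have ww: "w \<bullet> (S *\<^sub>v w) = 1"
    using q by simp
  show ?case
    by (rule exI[of _ "u(k := w)"]) (auto simp: less_Suc_eq u w ortho uw wu ww)
qed simp

text \<open>The columns of \<open>U\<close> are a full \<open>S\<close>-orthonormal family, whose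
  Gram matrix is the identity. \<open>U\<close> stands in for an inverse square root of
  \<open>S\<close>.\<close>

lemma PD_congruent_one:
  assumes S: "S \<in> PD n"
  obtains U where "U \<in> carrier_mat n n" "U\<^sup>T * (S * U) = 1\<^sub>m n"
proof -
  obtain u where u: "\<And>i. i < n \<Longrightarrow> u i \<in> carrier_vec n"
    and ortho: "\<And>i j. i < n \<Longrightarrow> j < n \<Longrightarrow> u i \<bullet> (S *\<^sub>v u j) = (if i = j then 1 else 0)"
    using PD_orthonormal_family[OF S order_refl] by auto
  note Sc = PD_carrier[OF S]
  define U where "U = mat n n (\<lambda>(i, j). u j $ i)"
  have U: "U \<in> carrier_mat n n"
    by (simp add: U_def)
  have col: "col U j = u j" if "j < n" for j
    using that u[OF that] by (intro eq_vecI) (auto simp: U_def)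
  have entry: "(U\<^sup>T * (S * U)) $$ (i, j) = u i \<bullet> (S *\<^sub>v u j)" if "i < n" "j < n" for i j
  proof -
    have "(U\<^sup>T * (S * U)) $$ (i, j) = col U i \<bullet> col (S * U) j"
      using that U Sc by (simp del: col_mult2)
    then show ?thesis
      using that by (simp only: col_mult2[OF Sc U] col)
  qed
  have "U\<^sup>T * (S * U) = 1\<^sub>m n"
    using U Sc by (intro eq_matI) (simp_all add: entry ortho del: index_mult_mat(1))
  with U show ?thesis
    by (rule that)
qed

section \<open>The Lyapunov operator\<close>

lemma trace_mult_commute:
  fixes A B :: "real mat"
  assumes "A \<in> carrier_mat n n" "B \<in> carrier_mat n n"
  shows "(\<Sum>i<n. (A * B) $$ (i, i)) = (\<Sum>i<n. (B * A) $$ (i, i))"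
proof -
  have "(\<Sum>i<n. (A * B) $$ (i, i)) = (\<Sum>i<n. \<Sum>j<n. A $$ (i, j) * B $$ (j, i))"
    using assms by (simp add: scalar_prod_def lessThan_atLeast0)
  also have "\<dots> = (\<Sum>j<n. \<Sum>i<n. B $$ (j, i) * A $$ (i, j))"
    by (subst sum.swap) (simp add: mult.commute)
  also have "\<dots> = (\<Sum>i<n. (B * A) $$ (i, i))"
    using assms by (simp add: scalar_prod_def lessThan_atLeast0)
  finally show ?thesis .
qed

lemma trace_square:
  fixes A :: "real mat"
  assumes "A \<in> carrier_mat n n"
  shows "(\<Sum>i<n. (A * A) $$ (i, i)) = (\<Sum>i<n. \<Sum>j<n. A $$ (i, j) * A $$ (j, i))"
  using assms by (simp add: scalar_prod_def lessThan_atLeast0)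

text \<open>
  \<open>M\<close> is similar to a skew-symmetric matrix \<open>N\<close>, so the trace of \<open>M\<^sup>2\<close> is minus the squared
  Frobenius norm of \<open>N\<close>; by the sparsity pattern it is also the sum of the squares of the
  diagonal entries of \<open>M\<close>.
\<close>

lemma lyapunov_kernel_trivial:
  assumes S: "S \<in> PD n" and M: "M \<in> carrier_mat n n"
    and eq: "M * S + S * M\<^sup>T = 0\<^sub>m n n"
    and sparse: "\<And>i j. i < n \<Longrightarrow> j < n \<Longrightarrow> i \<noteq> j \<Longrightarrow> M $$ (i, j) * M $$ (j, i) = 0"
  shows "M = 0\<^sub>m n n"
proof -
  note Sc = PD_carrier[OF S]
  obtain U where U: "U \<in> carrier_mat n n" and VW: "U\<^sup>T * (S * U) = 1\<^sub>m n"
    using PD_congruent_one[OF S] .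
  \<comment> \<open>\<open>V * W = 1\<close> for square matrices makes \<open>V\<close> and
    \<open>W\<close> mutually inverse, so \<open>N\<close> below is a conjugate of
    \<open>M\<close>.\<close>
  define V where "V = U\<^sup>T"
  define W where "W = S * U"
  have V: "V \<in> carrier_mat n n" and W: "W \<in> carrier_mat n n"
    using U Sc by (auto simp: V_def W_def)
  have WV: "W * V = 1\<^sub>m n"
    using mat_mult_left_right_inverse[OF V W] VW by (simp add: V_def W_def)
  define N where "N = V * M * W"
  have N: "N \<in> carrier_mat n n"
    using V W M by (simp add: N_def)
  have MSc: "M * S \<in> carrier_mat n n"
    using M Sc by auto
  have "S * M\<^sup>T = - (M * S)"
  proof (rule eq_matI)
    fix i j assume ij: "i < dim_row (- (M * S))" "j < dim_col (- (M * S))"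
    have "(M * S + S * M\<^sup>T) $$ (i, j) = 0"
      using ij M Sc by (simp add: eq)
    then show "(S * M\<^sup>T) $$ (i, j) = (- (M * S)) $$ (i, j)"
      using ij M Sc by simp
  qed (use M Sc in auto)
  then have skew: "(M * S)\<^sup>T = - (M * S)"
    using transpose_mult[OF M Sc] PD_transpose[OF S] by simp
  \<comment> \<open>The same \<open>N\<close> is also a congruence transform of \<open>M * S\<close>
    by \<open>U\<close>, and congruence preserves skew-symmetry.\<close>
  have N_eq: "N = V * ((M * S) * U)"
    unfolding N_def W_def using U V M Sc by (simp add: assoc_mult_mat[of _ n n _ n _ n])
  have "N\<^sup>T = ((M * S) * U)\<^sup>T * V\<^sup>T"
    unfolding N_eq using U V M Sc by (intro transpose_mult) auto
  also have "\<dots> = (V * (M * S)\<^sup>T) * U"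
    using transpose_mult[OF MSc U] by (simp add: V_def)
  also have "\<dots> = - (V * (M * S) * U)"
    unfolding skew using U V M Sc by simp
  also have "\<dots> = - N"
    unfolding N_eq using U V MSc by simp
  finally have NT: "N\<^sup>T = - N" .
  have N_skew: "N $$ (j, i) = - N $$ (i, j)" if "i < n" "j < n" for i j
  proof -
    have "N\<^sup>T $$ (i, j) = (- N) $$ (i, j)"
      by (simp add: NT)
    then show ?thesis
      using that N by simp
  qed

  \<comment> \<open>Bracketed so that cyclicity of the trace moves \<open>V\<close> to the far end,
    where \<open>W * V\<close> cancels and the trace of \<open>M * M\<close> remains.\<close>
  have NN: "N * N = V * (M * M * W)"
  proof -
    have "N * N = V * (M * ((W * V) * (M * W)))"
      unfolding N_def using V W M by (simp add: assoc_mult_mat[of _ n n _ n _ n])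
    then show ?thesis
      unfolding WV using V W M by (simp add: assoc_mult_mat[of _ n n _ n _ n])
  qed
  have MM: "M * M * W * V = M * M"
  proof -
    have "M * M * W * V = M * M * (W * V)"
      using V W M by (simp add: assoc_mult_mat[of _ n n _ n _ n])
    then show ?thesis
      unfolding WV using M by simp
  qed
  have "M * M * W \<in> carrier_mat n n"
    using W M by simp
  from trace_mult_commute[OF V this]
  have "(\<Sum>i<n. (N * N) $$ (i, i)) = (\<Sum>i<n. (M * M) $$ (i, i))"
    by (simp only: NN MM)
  then have "(\<Sum>i<n. \<Sum>j<n. N $$ (i, j) * N $$ (j, i)) =
      (\<Sum>i<n. \<Sum>j<n. M $$ (i, j) * M $$ (j, i))"
    by (simp add: trace_square[OF N] trace_square[OF M])
  moreover have "(\<Sum>i<n. \<Sum>j<n. M $$ (i, j) * M $$ (j, i)) \<ge> 0"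
  proof (intro sum_nonneg)
    fix i j assume "i \<in> {..<n}" "j \<in> {..<n}"
    then show "M $$ (i, j) * M $$ (j, i) \<ge> 0"
      using sparse[of i j] by (cases "i = j") auto
  qed
  moreover have "(\<Sum>i<n. \<Sum>j<n. N $$ (i, j) * N $$ (j, i)) =
      - (\<Sum>i<n. \<Sum>j<n. (N $$ (i, j))\<^sup>2)"
    unfolding sum_negf[symmetric]
  proof (intro sum.cong refl)
    fix i j assume "i \<in> {..<n}" "j \<in> {..<n}"
    then show "N $$ (i, j) * N $$ (j, i) = - (N $$ (i, j))\<^sup>2"
      using N_skew[of i j] by (simp add: power2_eq_square)
  qed
  ultimately have "(\<Sum>i<n. \<Sum>j<n. (N $$ (i, j))\<^sup>2) \<le> 0"
    by linarith
  then have "(\<Sum>i<n. \<Sum>j<n. (N $$ (i, j))\<^sup>2) = 0"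
    by (intro antisym sum_nonneg) auto
  then have "\<forall>i<n. \<forall>j<n. N $$ (i, j) = 0"
    by (simp add: sum_nonneg_eq_0_iff sum_nonneg)
  then have "N = 0\<^sub>m n n"
    using N by (intro eq_matI) auto
  \<comment> \<open>Undoing the conjugation carries \<open>N = 0\<close> back to
    \<open>M\<close>.\<close>
  moreover have "W * N * V = (W * V) * M * (W * V)"
    unfolding N_def using V W M by (simp add: assoc_mult_mat[of _ n n _ n _ n])
  ultimately show ?thesis
    unfolding WV using V W M by simp
qed

text \<open>For an eigenvector \<open>w\<close> of the transpose with eigenvalue \<open>z\<close>,
  pairing the equation with \<open>w\<close> on both sides gives 2 Re(z) w*Sw = -w*Cw < 0. Since
  \<open>PD\<close> is a real notion, this is carried out on the real and imaginary parts of
  \<open>w\<close>.\<close>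

lemma lyapunov_stable:
  assumes S: "S \<in> PD n" and C: "C \<in> PD n" and M: "M \<in> carrier_mat n n"
    and eq: "M * S + S * M\<^sup>T + C = 0\<^sub>m n n"
  shows "stable M"
  unfolding stable_def
proof (intro allI impI)
  fix z assume "eigenvalue (map_mat complex_of_real M) z"
  let ?M = "map_mat complex_of_real M"
  have Mc: "?M \<in> carrier_mat n n"
    using M by simp
  note Sc = PD_carrier[OF S] and Cc = PD_carrier[OF C]
  \<comment> \<open>A matrix and its transpose share the characteristic polynomial. A left
    eigenvector is needed because \<open>M\<^sup>T\<close> is the factor that meets the vector in
    \<open>S * M\<^sup>T\<close>.\<close>
  have "eigenvalue ?M\<^sup>T z"
    using \<open>eigenvalue ?M z\<close> Mc
    by (simp add: eigenvalue_root_char_poly[of _ n])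
  then obtain w where w: "w \<in> carrier_vec n" "w \<noteq> 0\<^sub>v n" and ev: "?M\<^sup>T *\<^sub>v w = z \<cdot>\<^sub>v w"
    using M unfolding eigenvalue_def eigenvector_def by auto
  define a where "a = map_vec Re w"
  define b where "b = map_vec Im w"
  have a: "a \<in> carrier_vec n" and b: "b \<in> carrier_vec n"
    using w by (auto simp: a_def b_def)
  have comp: "(\<Sum>i<n. M $$ (i, j) * w $ i) = z * w $ j" if "j < n" for j
  proof -
    have "(?M\<^sup>T *\<^sub>v w) $ j = (\<Sum>i<n. M $$ (i, j) * w $ i)"
      using that M w by (simp add: scalar_prod_def lessThan_atLeast0)
    then show ?thesis
      using that w by (simp add: ev)
  qed
  have Ma: "M\<^sup>T *\<^sub>v a = Re z \<cdot>\<^sub>v a - Im z \<cdot>\<^sub>v b"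
  proof (rule eq_vecI)
    fix j assume "j < dim_vec (Re z \<cdot>\<^sub>v a - Im z \<cdot>\<^sub>v b)"
    then have j: "j < n"
      using b by simp
    show "(M\<^sup>T *\<^sub>v a) $ j = (Re z \<cdot>\<^sub>v a - Im z \<cdot>\<^sub>v b) $ j"
      using arg_cong[OF comp[OF j], of Re] M w j
      by (simp add: a_def b_def scalar_prod_def lessThan_atLeast0)
  qed (use M a b in auto)
  have Mb: "M\<^sup>T *\<^sub>v b = Im z \<cdot>\<^sub>v a + Re z \<cdot>\<^sub>v b"
  proof (rule eq_vecI)
    fix j assume "j < dim_vec (Im z \<cdot>\<^sub>v a + Re z \<cdot>\<^sub>v b)"
    then have j: "j < n"
      using b by simp
    show "(M\<^sup>T *\<^sub>v b) $ j = (Im z \<cdot>\<^sub>v a + Re z \<cdot>\<^sub>v b) $ j"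
      using arg_cong[OF comp[OF j], of Im] M w j
      by (simp add: a_def b_def scalar_prod_def lessThan_atLeast0)
  qed (use M a b in auto)
  \<comment> \<open>The quadratic form of the equation at \<open>v\<close>: \<open>M * S\<close> and
    \<open>S * M\<^sup>T\<close> are transposes of each other and contribute equally, whence the
    factor 2.\<close>
  have form: "2 * (v \<bullet> (S *\<^sub>v (M\<^sup>T *\<^sub>v v))) + v \<bullet> (C *\<^sub>v v) = 0" if v: "v \<in> carrier_vec n" for v
  proof -
    have MT: "M\<^sup>T \<in> carrier_mat n n" and MTv: "M\<^sup>T *\<^sub>v v \<in> carrier_vec n"
      and Sv: "S *\<^sub>v v \<in> carrier_vec n"
      using M v Sc by auto
    have "v \<bullet> (M *\<^sub>v (S *\<^sub>v v)) = (M\<^sup>T *\<^sub>v v) \<bullet> (S *\<^sub>v v)"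
      using transpose_vec_mult_scalar[OF M Sv v] by simp
    also have "\<dots> = v \<bullet> (S *\<^sub>v (M\<^sup>T *\<^sub>v v))"
      by (rule PD_form_commute[OF S MTv v])
    finally have 1: "v \<bullet> (M *\<^sub>v (S *\<^sub>v v)) = v \<bullet> (S *\<^sub>v (M\<^sup>T *\<^sub>v v))" .
    have "M *\<^sub>v (S *\<^sub>v v) + S *\<^sub>v (M\<^sup>T *\<^sub>v v) + C *\<^sub>v v = (M * S + S * M\<^sup>T + C) *\<^sub>v v"
      using M MT Sc Cc v by (simp add: add_mult_distrib_mat_vec[of _ n n])
    also have "\<dots> = 0\<^sub>v n"
      unfolding eq using v by (intro eq_vecI) auto
    finally have "M *\<^sub>v (S *\<^sub>v v) + S *\<^sub>v (M\<^sup>T *\<^sub>v v) + C *\<^sub>v v = 0\<^sub>v n" .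
    then have "v \<bullet> (M *\<^sub>v (S *\<^sub>v v) + S *\<^sub>v (M\<^sup>T *\<^sub>v v) + C *\<^sub>v v) = 0"
      using v by simp
    moreover have "v \<bullet> (M *\<^sub>v (S *\<^sub>v v) + S *\<^sub>v (M\<^sup>T *\<^sub>v v) + C *\<^sub>v v) =
        v \<bullet> (M *\<^sub>v (S *\<^sub>v v)) + v \<bullet> (S *\<^sub>v (M\<^sup>T *\<^sub>v v)) + v \<bullet> (C *\<^sub>v v)"
      using M Sc Cc v MTv Sv by (simp add: scalar_prod_add_distrib[of _ n])
    ultimately show ?thesis
      using 1 by simp
  qed
  have Sa: "S *\<^sub>v (M\<^sup>T *\<^sub>v a) = Re z \<cdot>\<^sub>v (S *\<^sub>v a) - Im z \<cdot>\<^sub>v (S *\<^sub>v b)"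
    unfolding Ma using Sc a b by (simp add: mult_minus_distrib_mat_vec[of _ n n] mult_mat_vec)
  have Sb: "S *\<^sub>v (M\<^sup>T *\<^sub>v b) = Im z \<cdot>\<^sub>v (S *\<^sub>v a) + Re z \<cdot>\<^sub>v (S *\<^sub>v b)"
    unfolding Mb using Sc a b by (simp add: mult_add_distrib_mat_vec[of _ n n] mult_mat_vec)
  \<comment> \<open>The \<open>Im z\<close> terms of \<open>fa\<close> and \<open>fb\<close> are
    opposite by symmetry of \<open>S\<close> and cancel in the sum.\<close>
  have fa: "a \<bullet> (S *\<^sub>v (M\<^sup>T *\<^sub>v a)) = Re z * (a \<bullet> (S *\<^sub>v a)) - Im z * (a \<bullet> (S *\<^sub>v b))"
    unfolding Sa using Sc a b by (simp add: scalar_prod_minus_distrib[of _ n])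
  have fb: "b \<bullet> (S *\<^sub>v (M\<^sup>T *\<^sub>v b)) = Im z * (a \<bullet> (S *\<^sub>v b)) + Re z * (b \<bullet> (S *\<^sub>v b))"
    unfolding Sb using Sc a b PD_form_commute[OF S b a]
    by (simp add: scalar_prod_add_distrib[of _ n])
  have ab: "a \<noteq> 0\<^sub>v n \<or> b \<noteq> 0\<^sub>v n"
  proof (rule ccontr)
    assume "\<not> ?thesis"
    then have "Re (w $ i) = 0" "Im (w $ i) = 0" if "i < n" for i
      using that w by (auto simp: a_def b_def dest!: arg_cong[where f = "\<lambda>v. v $ i"])
    then have "w = 0\<^sub>v n"
      using w by (intro eq_vecI) (auto simp: complex_eq_iff)
    with w show False
      by simp
  qed
  \<comment> \<open>Only the sum is strictly positive, as one of \<open>a\<close> and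
    \<open>b\<close> may be zero.\<close>
  have pos: "a \<bullet> (P *\<^sub>v a) + b \<bullet> (P *\<^sub>v b) > 0" if P: "P \<in> PD n" for P
    using ab PD_pos[OF P a] PD_pos[OF P b] PD_nonneg[OF P a] PD_nonneg[OF P b] by fastforce
  have "2 * Re z * (a \<bullet> (S *\<^sub>v a) + b \<bullet> (S *\<^sub>v b)) = - (a \<bullet> (C *\<^sub>v a) + b \<bullet> (C *\<^sub>v b))"
    using form[OF a] form[OF b] unfolding fa fb by (simp add: algebra_simps)
  also have "\<dots> < 0"
    using pos[OF C] by simp
  finally show "Re z < 0"
    using pos[OF S] by (simp add: mult_less_0_iff)
qed

section \<open>The vectorised Lyapunov equation\<close>

text \<open>The unknowns of the linear system, in the order of the columns of \<open>A_mat\<close>;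
  the indices swap because the arc from \<open>i\<close> to \<open>j\<close> sits in row
  \<open>j\<close>, column \<open>i\<close>.\<close>

definition arc_vec :: "nat \<Rightarrow> nat pair_pre_digraph \<Rightarrow> real mat \<Rightarrow> real vec" where
  "arc_vec n G M = vec (card (parcs G)) (\<lambda>c. case arc_list n G ! c of (i, j) \<Rightarrow> M $$ (j, i))"

section \<open>Coordinates on symmetric matrices and on arcs\<close>

lemma vech_pairs_nth:
  assumes "r < (n + 1) choose 2" "vech_pairs n ! r = (k, l)"
  shows "k \<le> l" "l < n"
proof -
  have "(k, l) \<in> set (vech_pairs n)"
    using assms nth_mem[of r "vech_pairs n"] by (simp add: length_vech_pairs)
  then show "k \<le> l" "l < n"
    by (simp_all add: set_vech_pairs)
qed

lemma vech_uminus: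
  assumes C: "C \<in> carrier_mat n n"
  shows "vech n (- C) = - vech n C"
proof (rule eq_vecI)
  fix r assume "r < dim_vec (- vech n C)"
  then have r: "r < (n + 1) choose 2"
    by (simp add: vech_def)
  obtain k l where kl: "vech_pairs n ! r = (k, l)"
    by fastforce
  show "vech n (- C) $ r = (- vech n C) $ r"
    using r kl vech_pairs_nth[OF r kl] C by (simp add: vech_def)
qed (simp add: vech_def)

lemma vech_zero: "vech n (0\<^sub>m n n) = 0\<^sub>v ((n + 1) choose 2)"
proof (rule eq_vecI)
  fix r assume "r < dim_vec (0\<^sub>v ((n + 1) choose 2) :: real vec)"
  then have r: "r < (n + 1) choose 2"
    by simp
  obtain k l where kl: "vech_pairs n ! r = (k, l)"
    by fastforce
  show "vech n (0\<^sub>m n n) $ r = 0\<^sub>v ((n + 1) choose 2) $ r"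
    using r kl vech_pairs_nth[OF r kl] by (simp add: vech_def)
qed (simp add: vech_def)

lemma arc_vec_carrier: "arc_vec n G M \<in> carrier_vec (card (parcs G))"
  by (simp add: arc_vec_def)

lemma arc_index_nth:
  assumes "c < length (arc_list n G)"
  shows "arc_index n G (arc_list n G ! c) = c"
  unfolding arc_index_def
  using assms distinct_arc_list[of n G] by (intro the_equality) (auto simp: nth_eq_iff_index_eq)

lemma arc_index_arc:
  assumes "looped_digraph n G" "e \<in> parcs G"
  shows "arc_index n G e < card (parcs G)" "arc_list n G ! arc_index n G e = e"
proof -
  obtain c where "c < length (arc_list n G)" "arc_list n G ! c = e"
    using assms by (metis in_set_conv_nth set_arc_list)
  then show "arc_index n G e < card (parcs G)" "arc_list n G ! arc_index n G e = e"
    using arc_index_nth length_arc_list[OF assms(1)] by auto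
qed

lemma looped_arc_lt:
  assumes "looped_digraph n G" "(i, j) \<in> parcs G"
  shows "i < n" "j < n"
  using assms unfolding looped_digraph_def pair_fin_digraph_def pair_wf_digraph_def by force+

text \<open>Placing the coordinates at their arcs and 0 elsewhere gives the matrix. This turns
  kernel vectors and solutions of the linear system back into matrices.\<close>

lemma arc_vec_surj:
  assumes G: "looped_digraph n G" and x: "x \<in> carrier_vec (card (parcs G))"
  obtains M where "M \<in> graph_mats n G" "arc_vec n G M = x"
proof
  let ?M = "mat n n (\<lambda>(j, i). if (i, j) \<in> parcs G then x $ arc_index n G (i, j) else 0)"
  show "?M \<in> graph_mats n G"
    by (simp add: graph_mats_def)
  show "arc_vec n G ?M = x"
  proof (rule eq_vecI)
    fix c assume "c < dim_vec x"
    then have c: "c < card (parcs G)"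
      using x by simp
    obtain i j where ij: "arc_list n G ! c = (i, j)"
      by fastforce
    then have "(i, j) \<in> parcs G"
      using c by (metis G length_arc_list nth_mem set_arc_list)
    moreover have "arc_index n G (i, j) = c"
      using arc_index_nth[of c n G] c ij by (simp add: length_arc_list[OF G])
    ultimately show "arc_vec n G ?M $ c = x $ c"
      using c ij looped_arc_lt[OF G] by (simp add: arc_vec_def)
  qed (use x in \<open>simp add: arc_vec_def\<close>)
qed

text \<open>In row \<open>(k, l)\<close> only arcs into \<open>k\<close> or \<open>l\<close> count:
  those into \<open>k\<close> assemble the entry of \<open>M * S\<close>, those into
  \<open>l\<close> the entry of \<open>S * M\<^sup>T\<close>. So \<open>A_mat\<close> is the
  Lyapunov operator in coordinates.\<close>

lemma A_mat_mult_arc_vec: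
  assumes G: "looped_digraph n G" and M: "M \<in> graph_mats n G" and S: "S \<in> PD n"
  shows "A_mat n G S *\<^sub>v arc_vec n G M = vech n (M * S + S * M\<^sup>T)"
proof (rule eq_vecI)
  fix r assume "r < dim_vec (vech n (M * S + S * M\<^sup>T))"
  then have r: "r < (n + 1) choose 2"
    by (simp add: vech_def)
  note Sc = PD_carrier[OF S]
  have Mc: "M \<in> carrier_mat n n"
    using M by (simp add: graph_mats_def)
  obtain k l where kl: "vech_pairs n ! r = (k, l)"
    by fastforce
  have k: "k < n" and l: "l < n"
    using vech_pairs_nth[OF r kl] by auto
  define h where "h = (\<lambda>(i, j). A_entry S (k, l) (i, j) * M $$ (j, i))"
  have "(A_mat n G S *\<^sub>v arc_vec n G M) $ r = (\<Sum>c<card (parcs G). h (arc_list n G ! c))"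
    using r by (simp add: A_mat_def arc_vec_def scalar_prod_def lessThan_atLeast0 kl h_def
        split_beta)
  also have "\<dots> = sum_list (map h (arc_list n G))"
    by (simp add: sum_list_sum_nth length_arc_list[OF G] lessThan_atLeast0)
  also have "\<dots> = sum h (parcs G)"
    by (simp add: sum_list_distinct_conv_sum_set distinct_arc_list set_arc_list[OF G])
  \<comment> \<open>The sum extends from arcs to all pairs because \<open>M\<close> vanishes off the
    arcs.\<close>
  also have "\<dots> = sum h ({..<n} \<times> {..<n})"
    using M looped_arc_lt[OF G]
    by (intro sum.mono_neutral_left) (auto simp: h_def graph_mats_def)
  also have "\<dots> = (\<Sum>i<n. \<Sum>j<n. A_entry S (k, l) (i, j) * M $$ (j, i))"
    by (simp add: h_def sum.cartesian_product)
  \<comment> \<open>For \<open>k = l\<close> both conditions hold at once and the two equal summands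
    account for the factor 2 in \<open>A_entry\<close>.\<close>
  also have "\<dots> = (\<Sum>i<n. \<Sum>j<n. (if j = k then M $$ (k, i) * S $$ (l, i) else 0) +
      (if j = l then S $$ (k, i) * M $$ (l, i) else 0))"
    by (intro sum.cong refl) (auto simp: A_entry_def)
  also have "\<dots> = (\<Sum>i<n. M $$ (k, i) * S $$ (l, i)) + (\<Sum>i<n. S $$ (k, i) * M $$ (l, i))"
    using k l by (simp add: sum.distrib)
  also have "(\<Sum>i<n. M $$ (k, i) * S $$ (l, i)) = (\<Sum>i<n. M $$ (k, i) * S $$ (i, l))"
    using l by (intro sum.cong refl) (simp add: PD_sym_entry[OF S])
  also have "\<dots> + (\<Sum>i<n. S $$ (k, i) * M $$ (l, i)) = (M * S + S * M\<^sup>T) $$ (k, l)"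
    using k l Mc Sc by (simp add: scalar_prod_def lessThan_atLeast0)
  also have "\<dots> = vech n (M * S + S * M\<^sup>T) $ r"
    using r kl by (simp add: vech_def)
  finally show "(A_mat n G S *\<^sub>v arc_vec n G M) $ r = vech n (M * S + S * M\<^sup>T) $ r" .
qed (simp add: vech_def A_mat_def)

lemma vech_inj:
  assumes "A \<in> carrier_mat n n" "B \<in> carrier_mat n n" "A\<^sup>T = A" "B\<^sup>T = B"
    and eq: "vech n A = vech n B"
  shows "A = B"
proof -
  have upper: "A $$ (k, l) = B $$ (k, l)" if "k \<le> l" "l < n" for k l
  proof -
    have "(k, l) \<in> set (vech_pairs n)"
      using that by (simp add: set_vech_pairs)
    then obtain r where "r < (n + 1) choose 2" "vech_pairs n ! r = (k, l)"
      by (metis in_set_conv_nth length_vech_pairs)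
    then show ?thesis
      using arg_cong[OF eq, of "\<lambda>v. v $ r"] by (simp add: vech_def)
  qed
  show ?thesis
  proof (rule eq_matI)
    fix k l assume "k < dim_row B" "l < dim_col B"
    then have kl: "k < n" "l < n"
      using assms by auto
    then have "A $$ (k, l) = A $$ (l, k)" "B $$ (k, l) = B $$ (l, k)"
      using assms by (metis carrier_matD index_transpose_mat(1))+
    then show "A $$ (k, l) = B $$ (k, l)"
      using upper[of k l] upper[of l k] kl by (cases "k \<le> l") auto
  qed (use assms in auto)
qed

text \<open>Both \<open>M * S + S * M\<^sup>T\<close> and \<open>C\<close> are symmetric, so passing
  to the upper triangle by \<open>vech\<close> loses no equation.\<close>

lemma A_mat_eq_iff_lyapunov:
  assumes G: "looped_digraph n G" and M: "M \<in> graph_mats n G" and S: "S \<in> PD n"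
    and C: "C \<in> carrier_mat n n" "C\<^sup>T = C"
  shows "A_mat n G S *\<^sub>v arc_vec n G M = - vech n C \<longleftrightarrow> M * S + S * M\<^sup>T + C = 0\<^sub>m n n"
proof -
  note Sc = PD_carrier[OF S]
  have Mc: "M \<in> carrier_mat n n"
    using M by (simp add: graph_mats_def)
  let ?L = "M * S + S * M\<^sup>T"
  have L: "?L \<in> carrier_mat n n"
    using Mc Sc by simp
  have LT: "?L\<^sup>T = ?L"
    using Mc Sc PD_transpose[OF S]
    by (simp add: transpose_add[of _ n n] transpose_mult[of _ n n _ n] comm_add_mat[of _ n n])
  have "vech n ?L = vech n (- C) \<longleftrightarrow> ?L = - C"
    using vech_inj[of ?L n "- C"] L LT C by (auto simp: transpose_uminus)
  moreover have "?L = - C \<longleftrightarrow> ?L + C = 0\<^sub>m n n"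
  proof
    assume "?L = - C"
    then show "?L + C = 0\<^sub>m n n"
      using C(1) by (simp add: uminus_l_inv_mat)
  next
    assume *: "?L + C = 0\<^sub>m n n"
    show "?L = - C"
    proof (rule eq_matI)
      fix i j assume "i < dim_row (- C)" "j < dim_col (- C)"
      then show "?L $$ (i, j) = (- C) $$ (i, j)"
        using arg_cong[OF *, of "\<lambda>A. A $$ (i, j)"] C(1) L by simp
    qed (use L C in auto)
  qed
  ultimately show ?thesis
    by (simp add: A_mat_mult_arc_vec[OF G M S] vech_uminus[OF C(1), symmetric])
qed

text \<open>The arc count makes the matrix square, and a kernel vector is a matrix \<open>M\<close>
  solving the homogeneous equation. Simplicity excludes opposite arcs, which is the sparsity that
  \<open>lyapunov_kernel_trivial\<close> asks for.\<close>

lemma A_mat_det_nonzero: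
  assumes G: "simple_digraph n G" and card: "card (parcs G) = (n + 1) choose 2"
    and S: "S \<in> PD n"
  shows "det (A_mat n G S) \<noteq> 0"
proof
  let ?N = "card (parcs G)"
  assume "det (A_mat n G S) = 0"
  have A: "A_mat n G S \<in> carrier_mat ?N ?N"
    by (simp add: A_mat_def card)
  have loop: "looped_digraph n G"
    using G by (simp add: simple_digraph_def)
  obtain x where x: "x \<in> carrier_vec ?N" "x \<noteq> 0\<^sub>v ?N" "A_mat n G S *\<^sub>v x = 0\<^sub>v ?N"
    using \<open>det (A_mat n G S) = 0\<close> det_0_iff_vec_prod_zero_field[OF A] by blast
  obtain M where M: "M \<in> graph_mats n G" and Mx: "arc_vec n G M = x"
    using arc_vec_surj[OF loop x(1)] .
  have Mc: "M \<in> carrier_mat n n"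
    using M by (simp add: graph_mats_def)
  have vech0: "- vech n (0\<^sub>m n n) = 0\<^sub>v ?N"
    unfolding card vech_zero by (intro eq_vecI) auto
  \<comment> \<open>The homogeneous system is the equivalence at \<open>C = 0\<close>, which is
    symmetric though not always positive definite.\<close>
  have "M * S + S * M\<^sup>T + 0\<^sub>m n n = 0\<^sub>m n n"
    using A_mat_eq_iff_lyapunov[OF loop M S, of "0\<^sub>m n n"] x(3) by (simp add: vech0 Mx)
  then have "M * S + S * M\<^sup>T = 0\<^sub>m n n"
    using Mc PD_carrier[OF S] by simp
  moreover have "M $$ (i, j) * M $$ (j, i) = 0" if "i < n" "j < n" "i \<noteq> j" for i j
  proof (cases "(i, j) \<in> parcs G")
    case True
    then have "(j, i) \<notin> parcs G"
      using G that unfolding simple_digraph_def by blast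
    then show ?thesis
      using M that by (simp add: graph_mats_def)
  next
    case False
    then show ?thesis
      using M that by (simp add: graph_mats_def)
  qed
  ultimately have "M = 0\<^sub>m n n"
    by (intro lyapunov_kernel_trivial[OF S Mc]) auto
  have "x = 0\<^sub>v ?N"
  proof (rule eq_vecI)
    fix c assume "c < dim_vec (0\<^sub>v ?N)"
    then have c: "c < ?N"
      by simp
    obtain i j where ij: "arc_list n G ! c = (i, j)"
      by fastforce
    then have "(i, j) \<in> parcs G"
      using c by (metis loop length_arc_list nth_mem set_arc_list)
    then show "x $ c = 0\<^sub>v ?N $ c"
      using c ij looped_arc_lt[OF loop] unfolding Mx[symmetric] \<open>M = 0\<^sub>m n n\<close>
      by (simp add: arc_vec_def)
  qed (use x in simp)
  with x show False
    by simp
qed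

text \<open>Cramer's rule in multiplied form: the inserted column is \<open>A_mat\<close> times the
  vector of unknowns, so the determinant picks out one unknown times
  \<open>det (A_mat n G S)\<close>.\<close>

lemma f_poly_cramer:
  assumes G: "looped_digraph n G" and card: "card (parcs G) = (n + 1) choose 2"
    and e: "(i, j) \<in> parcs G" and eq: "A_mat n G S *\<^sub>v arc_vec n G M = - vech n C"
  shows "f_poly n G (i, j) S C = M $$ (j, i) * det (A_mat n G S)"
proof -
  have "A_mat n G S \<in> carrier_mat (card (parcs G)) (card (parcs G))"
    by (simp add: A_mat_def card)
  from cramer_lemma_mat[OF this arc_vec_carrier[of n G M] arc_index_arc(1)[OF G e]]
  have "f_poly n G (i, j) S C = arc_vec n G M $ arc_index n G (i, j) * det (A_mat n G S)"
    by (simp add: f_poly_def A_repl_def eq)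
  then show ?thesis
    using arc_index_arc[OF G e] by (simp add: arc_vec_def)
qed

section \<open>The membership criterion\<close>

theorem proposition2p6:
  fixes n :: nat and G G' :: "nat pair_pre_digraph" and C S :: "real mat"
  assumes "simple_digraph n G"
    and "C \<in> PD n"
    and "completion n G G'"
    and "S \<in> PD n"
  shows "S \<in> lyapunov_model n G C \<longleftrightarrow>
    (\<forall>i j. (i, j) \<in> parcs G' - parcs G \<longrightarrow> f_poly n G' (i, j) S C = 0)"
proof -
  note S = assms(4) and C = assms(2)
  let ?N = "card (parcs G')" and ?A = "A_mat n G' S"
  have simple: "simple_digraph n G'" and sub: "parcs G \<subseteq> parcs G'"
    and card: "?N = (n + 1) choose 2"
    using assms(3) by (auto simp: completion_def)
  have G': "looped_digraph n G'"
    using simple by (simp add: simple_digraph_def)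
  have det: "det ?A \<noteq> 0"
    by (rule A_mat_det_nonzero[OF simple card S])
  note iff = A_mat_eq_iff_lyapunov[OF G' _ S PD_carrier[OF C] PD_transpose[OF C]]
  note cramer = f_poly_cramer[OF G' card]
  show ?thesis
  proof
    assume "S \<in> lyapunov_model n G C"
    then obtain M where M: "M \<in> graph_mats n G" and eq: "M * S + S * M\<^sup>T + C = 0\<^sub>m n n"
      by (auto simp: lyapunov_model_def)
    \<comment> \<open>The system lives on \<open>G'\<close>, so \<open>M\<close> is viewed there;
      its entries at arcs outside \<open>G\<close> are 0, and Cramer's rule passes this on to
      \<open>f_poly\<close>.\<close>
    have "M \<in> graph_mats n G'"
      using M sub by (auto simp: graph_mats_def)
    with eq have "?A *\<^sub>v arc_vec n G' M = - vech n C"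
      by (simp add: iff)
    then show "\<forall>i j. (i, j) \<in> parcs G' - parcs G \<longrightarrow> f_poly n G' (i, j) S C = 0"
      using cramer M looped_arc_lt[OF G'] by (auto simp: graph_mats_def)
  next
    assume f: "\<forall>i j. (i, j) \<in> parcs G' - parcs G \<longrightarrow> f_poly n G' (i, j) S C = 0"
    have A: "?A \<in> carrier_mat ?N ?N"
      by (simp add: A_mat_def card)
    \<comment> \<open>A right inverse of \<open>?A\<close> supplies the solution; \<open>()\<close>
      merely fills the dummy parameter of the matrix ring.\<close>
    obtain B where B: "B \<in> carrier_mat ?N ?N" "?A * B = 1\<^sub>m ?N"
      using det_non_zero_imp_unit[OF A det, of "()"] by (auto simp: Units_def ring_mat_def)
    have v: "- vech n C \<in> carrier_vec ?N"
      by (simp add: vech_def card carrier_dim_vec)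
    obtain M where M: "M \<in> graph_mats n G'" and "arc_vec n G' M = B *\<^sub>v (- vech n C)"
      using arc_vec_surj[OF G', of "B *\<^sub>v (- vech n C)"] B v by auto
    then have Ax: "?A *\<^sub>v arc_vec n G' M = - vech n C"
      using assoc_mult_mat_vec[OF A B(1) v] B(2) v by simp
    then have eq: "M * S + S * M\<^sup>T + C = 0\<^sub>m n n"
      using iff[OF M] by simp
    \<comment> \<open>At arcs of \<open>G'\<close> outside \<open>G\<close>, the entry times the
      nonzero \<open>det ?A\<close> equals \<open>f_poly\<close>, which is 0; off \<open>G'\<close>
      the support of \<open>M\<close> suffices.\<close>
    have "M $$ (j, i) = 0" if "i < n" "j < n" "(i, j) \<notin> parcs G" for i j
    proof (cases "(i, j) \<in> parcs G'")
      case True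
      then show ?thesis
        using f that cramer[OF True Ax] det by auto
    next
      case False
      then show ?thesis
        using M that by (simp add: graph_mats_def)
    qed
    then have "M \<in> graph_mats n G"
      using M by (simp add: graph_mats_def)
    moreover have "stable M"
      using lyapunov_stable[OF S C _ eq] M by (simp add: graph_mats_def)
    ultimately show "S \<in> lyapunov_model n G C"
      using S eq by (auto simp: lyapunov_model_def)
  qed
qed

end
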